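(* Let $p$ be a prime and let $A,B\in\mathbb C_p[x]$ be nonzero polynomials such that $\deg A\not\equiv\deg B \pmod 2$. Then the equation $$A(x)f^2(x)+B(x)g^2(x)=1$$ has no solutions $(f,g)$ in $(\mathcal A(\mathbb C_p))^2\setminus\mathbb C_p^2$; that is, every solution $(f,g)\in(\mathcal A(\mathbb C_p))^2$ consists of two constant functions.
   Context: $\mathbb C_p$ is the field of complex $p$-adic numbers (the completion of an algebraic closure of $\mathbb Q_p$). $\mathcal A(\mathbb C_p)$ is the ring of entire functions on $\mathbb C_p$, i.e. power series $\sum_{i\ge 0}c_ix^i$ with $c_i\in\mathbb C_p$ that converge on all of $\mathbb C_p$. Constants in $\mathbb C_p$ are regarded as constant entire functions. *)

theory Defs
  imports
    "HOL-Analysis.Abstract_Metric_Spaces"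
    "HOL-Number_Theory.Cong"
    "HOL-Algebra.Algebraic_Closure_Type"
begin

definition padic_abs :: "nat \<Rightarrow> rat \<Rightarrow> real" where
  "padic_abs p x =
     (if x = 0 then 0
      else real p powi (int (multiplicity (int p) (snd (quotient_of x)))
                        - int (multiplicity (int p) (fst (quotient_of x)))))"

locale nonarch_valued_field =
  fixes nrm :: "'a :: field \<Rightarrow> real"
  assumes nrm_nonneg: "0 \<le> nrm x"
    and nrm_eq_0_iff: "nrm x = 0 \<longleftrightarrow> x = 0"
    and nrm_mult: "nrm (x * y) = nrm x * nrm y"
    and nrm_ultra: "nrm (x + y) \<le> max (nrm x) (nrm y)"
begin

lemma nrm_minus: "nrm (- x) = nrm x"
proof -
  have "nrm (-1) * nrm (-1) = 1"
    using nrm_mult[of "-1" "-1"] nrm_mult[of 1 1] nrm_eq_0_iff[of 1] by simp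
  hence "(nrm (-1))\<^sup>2 = 1"
    by (simp add: power2_eq_square)
  hence "nrm (-1) = 1"
    using nrm_nonneg[of "-1"] by (simp add: power2_eq_1_iff)
  thus ?thesis
    using nrm_mult[of "-1" x] by simp
qed

sublocale Metric_space "UNIV :: 'a set" "\<lambda>x y. nrm (x - y)"
proof
  fix x y z :: 'a
  show "nrm (x - y) = nrm (y - x)"
    using nrm_minus[of "x - y"] by simp
  have "nrm (x - z) \<le> max (nrm (x - y)) (nrm (y - z))"
    using nrm_ultra[of "x - y" "y - z"] by simp
  thus "nrm (x - z) \<le> nrm (x - y) + nrm (y - z)"
    using nrm_nonneg[of "x - y"] nrm_nonneg[of "y - z"] by linarith
qed (simp_all add: nrm_nonneg nrm_eq_0_iff)

end

(* The completion of an algebraic closure of Q_p is determined only up to isometric isomorphism;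
   the locale says that the valued field ('a, nrm) is such a completion.
   Since 'a is complete and nrm restricts to the p-adic absolute value on the rationals,
   the closure Qp of the rationals in 'a is the completion of (Q, padic_abs p).
   Inside 'a there is an algebraic closure L of Qp, and L is dense in the complete field 'a. *)
locale complex_padic_field = nonarch_valued_field nrm
  for p :: nat and nrm :: "'a :: field_char_0 \<Rightarrow> real" +
  assumes nrm_of_rat: "nrm (of_rat q) = padic_abs p q"
    and complete: "mcomplete"
    and dense_algebraic_closure:
      "\<exists>L. algebraic_closure (ring_of_type_algebra \<lparr> carrier := L \<rparr>)
             (mtopology closure_of (range of_rat)) \<and>
           mtopology closure_of L = UNIV"

context nonarch_valued_field
begin

definition entire_functions :: "('a \<Rightarrow> 'a) set" where
  "entire_functions =
     {f. \<exists>c :: nat \<Rightarrow> 'a. \<forall>x. limitin mtopology (\<lambda>n. \<Sum>i<n. c i * x ^ i) (f x) sequentially}"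

end

definition constant_functions :: "('a \<Rightarrow> 'a) set" where
  "constant_functions = range (\<lambda>c x. c)"

end

theory Submission
  imports Defs "HOL-Computational_Algebra.Polynomial_FPS"
begin

text \<open>
  The proof is a degree count that survives the passage from polynomials to entire functions.
  For a power series \<open>F\<close> and a radius \<open>r\<close>, the central index is the last \<open>k\<close> at which
  \<open>|F\<^sub>k| r\<^sup>k\<close> attains its maximum, the Gauss norm of \<open>F\<close> at radius \<open>r\<close>. (Over a complete
  algebraically closed field it is the number of zeros of \<open>F\<close> in the closed disc of radius \<open>r\<close>.)
  By the ultrametric inequality central indices add under products
  (\<open>central_index_mult\<close>), and passing from \<open>F\<close> to \<open>1 - F\<close> does not change the central index once
  the Gauss norm exceeds 1, because only the constant coefficient is touched
  (\<open>central_index_one_minus\<close>). The central index of a nonzero polynomial at a large radius is its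
  degree (\<open>central_index_poly\<close>).

  Now suppose \<open>A F\<^sup>2 + B G\<^sup>2 = 1\<close> with \<open>F\<close> not constant. The Gauss norm of \<open>A F\<^sup>2\<close> tends to infinity
  with \<open>r\<close>, so at a large radius \<open>A F\<^sup>2\<close> and \<open>B G\<^sup>2 = 1 - A F\<^sup>2\<close> have the same central index. It is
  \<open>deg A + 2 k\<close> on one side and \<open>deg B + 2 l\<close> on the other, so \<open>deg A\<close> and \<open>deg B\<close> have the same
  parity. The equation is symmetric, hence the same contradiction arises if \<open>G\<close> is not constant.

  The equation between functions becomes one between power series because the Cauchy product
  of two convergent series represents the product of the sums (\<open>fps_sums_mult\<close>) and a series
  whose sum vanishes everywhere is zero (\<open>fps_eq_0_if_sums_0\<close>). This and the
  existence of central indices at every radius use points of arbitrarily small and large norm,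
  namely the powers of an element \<open>t\<close> with \<open>|t| > 1\<close>; here \<open>t = 1/p\<close> (\<open>nrm_inverse_prime\<close>).
\<close>

unbundle no vec_syntax
unbundle fps_syntax

context nonarch_valued_field
begin

section \<open>Ultrametric sums\<close>

lemma nrm_zero [simp]: "nrm 0 = 0"
  using nrm_eq_0_iff by simp

lemma nrm_pos_iff: "0 < nrm x \<longleftrightarrow> x \<noteq> 0"
  using nrm_nonneg[of x] nrm_eq_0_iff[of x] by linarith

lemma nrm_one [simp]: "nrm 1 = 1"
  using nrm_mult[of 1 1] nrm_eq_0_iff[of 1] by simp

lemma nrm_power: "nrm (x ^ n) = nrm x ^ n"
  by (induction n) (simp_all add: nrm_mult)

lemma nrm_triangle: "nrm (x + y) \<le> nrm x + nrm y"
  using nrm_ultra[of x y] nrm_nonneg[of x] nrm_nonneg[of y] by linarith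

lemma nrm_triangle4: "nrm (x + (y + (z + w))) \<le> nrm x + (nrm y + (nrm z + nrm w))"
  using nrm_triangle[of x "y + (z + w)"] nrm_triangle[of y "z + w"] nrm_triangle[of z w] by linarith

lemma nrm_sum_le:
  assumes "\<And>i. i \<in> S \<Longrightarrow> nrm (f i) \<le> c" and "0 \<le> c"
  shows "nrm (sum f S) \<le> c"
  using assms
proof (induction S rule: infinite_finite_induct)
  case (insert i S)
  have "nrm (f i + sum f S) \<le> max (nrm (f i)) (nrm (sum f S))"
    by (rule nrm_ultra)
  with insert show ?case by fastforce
qed simp_all

lemma nrm_sum_less:
  assumes "\<And>i. i \<in> S \<Longrightarrow> nrm (f i) < c" and "0 < c"
  shows "nrm (sum f S) < c"
  using assms
proof (induction S rule: infinite_finite_induct)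
  case (insert i S)
  have "nrm (f i + sum f S) \<le> max (nrm (f i)) (nrm (sum f S))"
    by (rule nrm_ultra)
  with insert show ?case by fastforce
qed simp_all

text \<open>
  The isosceles triangle principle: were the sum smaller than \<open>x\<close>, then
  \<open>x = (x + y) - y\<close> would be a sum of two elements that are both smaller than \<open>x\<close>.
\<close>
lemma nrm_add_dominant:
  assumes "nrm y < nrm x"
  shows "nrm (x + y) = nrm x"
proof -
  have "nrm (x + y) \<le> nrm x"
    using nrm_ultra[of x y] assms by simp
  moreover have "nrm x \<le> max (nrm (x + y)) (nrm y)"
    using nrm_ultra[of "x + y" "- y"] by (simp add: nrm_minus)
  ultimately show ?thesis using assms by linarith
qed

section \<open>Values of power series\<close>

text \<open>
  Convergence is expressed by real null sequences rather than by \<^const>\<open>limitin\<close>, so that the limit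
  rules for real sequences apply.
\<close>
definition fps_sums :: "'a fps \<Rightarrow> 'a \<Rightarrow> 'a \<Rightarrow> bool" where
  "fps_sums F x y \<longleftrightarrow> (\<lambda>n. nrm ((\<Sum>i<n. F $ i * x ^ i) - y)) \<longlonglongrightarrow> 0"

lemma nrm_tendsto_zero_le:
  assumes "u \<longlonglongrightarrow> 0" and "\<And>n. nrm (s n) \<le> u n"
  shows "(\<lambda>n. nrm (s n)) \<longlonglongrightarrow> 0"
  by (rule tendsto_sandwich[OF _ _ tendsto_const assms(1)]) (simp_all add: nrm_nonneg assms(2))

lemma entire_function_fps:
  assumes "f \<in> entire_functions"
  shows "\<exists>F. \<forall>x. fps_sums F x (f x)"
proof -
  obtain c where "\<And>x. limitin mtopology (\<lambda>n. \<Sum>i<n. c i * x ^ i) (f x) sequentially"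
    using assms by (auto simp: entire_functions_def)
  then have "fps_sums (Abs_fps c) x (f x)" for x
    by (simp add: fps_sums_def limitin_metric_dist_null)
  then show ?thesis by blast
qed

lemma fps_sums_diff:
  assumes "fps_sums F x a" and "fps_sums G x b"
  shows "fps_sums (F - G) x (a - b)"
proof -
  let ?s = "\<lambda>H n. \<Sum>i<n. H $ i * x ^ i"
  have eq: "?s (F - G) n - (a - b) = (?s F n - a) + - (?s G n - b)" for n
    by (simp add: sum_subtractf algebra_simps)
  have "nrm (?s (F - G) n - (a - b)) \<le> nrm (?s F n - a) + nrm (?s G n - b)" for n
    using nrm_triangle[of "?s F n - a" "- (?s G n - b)"]
    unfolding nrm_minus eq[of n, symmetric] .
  moreover have "(\<lambda>n. nrm (?s F n - a) + nrm (?s G n - b)) \<longlonglongrightarrow> 0"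
    using tendsto_add[OF assms[unfolded fps_sums_def]] by simp
  ultimately show ?thesis
    unfolding fps_sums_def by (rule nrm_tendsto_zero_le[rotated])
qed

lemma fps_sums_poly: "fps_sums (fps_of_poly P) x (poly P x)"
proof -
  let ?d = "Polynomial.degree P"
  have "nrm ((\<Sum>i<n. fps_of_poly P $ i * x ^ i) - poly P x) = 0" if "n > ?d" for n
  proof -
    have "(\<Sum>i\<le>?d. Polynomial.coeff P i * x ^ i) = (\<Sum>i<n. Polynomial.coeff P i * x ^ i)"
    proof (rule sum.mono_neutral_left)
      show "\<forall>i\<in>{..<n} - {..?d}. Polynomial.coeff P i * x ^ i = 0"
        by (simp add: Polynomial.coeff_eq_0)
    qed (use that in auto)
    then show ?thesis by (simp only: poly_altdef fps_of_poly_nth diff_self nrm_zero)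
  qed
  then have "\<forall>n\<ge>Suc ?d. nrm ((\<Sum>i<n. fps_of_poly P $ i * x ^ i) - poly P x) = 0"
    by (intro allI impI) (simp only: Suc_le_eq)
  then have "eventually (\<lambda>n. nrm ((\<Sum>i<n. fps_of_poly P $ i * x ^ i) - poly P x) = 0) sequentially"
    unfolding eventually_sequentially by (rule exI)
  then show ?thesis
    unfolding fps_sums_def by (rule tendsto_eventually)
qed

lemma fps_sums_terms_tendsto_zero:
  assumes "fps_sums F x a"
  shows "(\<lambda>n. nrm (F $ n * x ^ n)) \<longlonglongrightarrow> 0"
proof -
  let ?d = "\<lambda>n. (\<Sum>i<n. F $ i * x ^ i) - a"
  have lim: "(\<lambda>n. nrm (?d n)) \<longlonglongrightarrow> 0"
    using assms by (simp add: fps_sums_def)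
  have eq: "F $ n * x ^ n = ?d (Suc n) + - ?d n" for n
    by simp
  have "nrm (F $ n * x ^ n) \<le> nrm (?d (Suc n)) + nrm (?d n)" for n
    using nrm_triangle[of "?d (Suc n)" "- ?d n"]
    unfolding nrm_minus eq[of n, symmetric] .
  moreover have "(\<lambda>n. nrm (?d (Suc n)) + nrm (?d n)) \<longlonglongrightarrow> 0"
    using tendsto_add[OF LIMSEQ_Suc[OF lim] lim] by simp
  ultimately show ?thesis
    by (rule nrm_tendsto_zero_le[rotated])
qed

lemma fps_sums_terms_bounded:
  assumes "fps_sums F x a"
  shows "\<exists>M>0. \<forall>n. nrm (F $ n * x ^ n) \<le> M"
proof -
  have "Bseq (\<lambda>n. nrm (F $ n * x ^ n))"
    by (rule convergent_imp_Bseq[OF convergentI[OF fps_sums_terms_tendsto_zero[OF assms]]])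
  then obtain M where "M > 0" and M: "\<forall>n. norm (nrm (F $ n * x ^ n)) \<le> M"
    by (rule BseqE)
  then have "\<forall>n. nrm (F $ n * x ^ n) \<le> M"
    by (simp add: nrm_nonneg)
  with \<open>M > 0\<close> show ?thesis by (intro exI conjI)
qed

text \<open>
  The product of the \<open>n\<close>-th partial sums and the \<open>n\<close>-th
  partial sum of the Cauchy product differ by terms \<open>u\<^sub>i v\<^sub>j\<close> with \<open>i + j \<ge> n\<close>. One factor
  of such a term has a large index, hence is small, and the other is bounded; an ultrametric sum
  is no larger than its largest term.
\<close>
lemma fps_sums_mult:
  assumes "fps_sums F x a" and "fps_sums G x b"
  shows "fps_sums (F * G) x (a * b)"
proof -
  define u v where "u i = F $ i * x ^ i" and "v i = G $ i * x ^ i" for i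
  define U V W where "U n = sum u {..<n}" and "V n = sum v {..<n}"
    and "W n = (\<Sum>i<n. (F * G) $ i * x ^ i)" for n
  have limU: "(\<lambda>n. nrm (U n - a)) \<longlonglongrightarrow> 0" and limV: "(\<lambda>n. nrm (V n - b)) \<longlonglongrightarrow> 0"
    using assms unfolding fps_sums_def U_def V_def u_def v_def by this+
  obtain M where "M > 0" and "\<forall>n. nrm (u n) \<le> M"
    using fps_sums_terms_bounded[OF assms(1)] unfolding u_def by blast
  then have M: "M > 0" "\<And>n. nrm (u n) \<le> M"
    by simp_all
  obtain N where "N > 0" and "\<forall>n. nrm (v n) \<le> N"
    using fps_sums_terms_bounded[OF assms(2)] unfolding v_def by blast
  then have N: "N > 0" "\<And>n. nrm (v n) \<le> N"
    by simp_all
  have W: "W n = (\<Sum>(i,j) | i + j < n. u i * v j)" for n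
  proof -
    have "(F * G) $ k * x ^ k = (\<Sum>i\<le>k. u i * v (k - i))" for k
    proof -
      have "F $ i * G $ (k - i) * x ^ k = u i * v (k - i)" if "i \<le> k" for i
      proof -
        have "x ^ k = x ^ i * x ^ (k - i)" using that by (simp flip: power_add)
        then show ?thesis by (simp add: u_def v_def)
      qed
      then show ?thesis
        by (simp add: fps_mult_nth atLeast0AtMost sum_distrib_right)
    qed
    then show ?thesis by (simp add: W_def sum.triangle_reindex)
  qed
  have tail: "(\<lambda>n. nrm (U n * V n - W n)) \<longlonglongrightarrow> 0"
  proof (rule LIMSEQ_I)
    fix e :: real assume e: "e > 0"
    have "(\<lambda>n. nrm (u n)) \<longlonglongrightarrow> 0" "(\<lambda>n. nrm (v n)) \<longlonglongrightarrow> 0"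
      using fps_sums_terms_tendsto_zero assms unfolding u_def v_def by blast+
    then have "eventually (\<lambda>n. nrm (u n) < e / N) sequentially"
      "eventually (\<lambda>n. nrm (v n) < e / M) sequentially"
      using e M(1) N(1) by (simp_all add: order_tendstoD(2))
    then have "eventually (\<lambda>n. nrm (u n) < e / N \<and> nrm (v n) < e / M) sequentially"
      by (rule eventually_conj)
    then obtain K where "\<forall>n\<ge>K. nrm (u n) < e / N \<and> nrm (v n) < e / M"
      unfolding eventually_sequentially by (rule exE)
    then have K: "nrm (u n) < e / N" "nrm (v n) < e / M" if "n \<ge> K" for n
      using that by simp_all
    have small: "nrm (u i * v j) < e" if "i + j \<ge> 2 * K" for i j
    proof (cases "i \<ge> K")
      case True
      have "nrm (u i * v j) \<le> nrm (u i) * N"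
        unfolding nrm_mult by (intro mult_left_mono N nrm_nonneg)
      also have "\<dots> < e"
        using K(1)[OF True] N(1) by (simp add: field_simps)
      finally show ?thesis .
    next
      case False
      then have "j \<ge> K" using that by simp
      have "nrm (u i * v j) \<le> M * nrm (v j)"
        unfolding nrm_mult by (intro mult_right_mono M nrm_nonneg)
      also have "\<dots> < e"
        using K(2)[OF \<open>j \<ge> K\<close>] M(1) by (simp add: field_simps)
      finally show ?thesis .
    qed
    have "nrm (U n * V n - W n) < e" if n: "n \<ge> 2 * K" for n
    proof -
      let ?T = "{(i, j). i + j < n}"
      have "U n * V n = (\<Sum>(i,j) \<in> {..<n} \<times> {..<n}. u i * v j)"
        by (simp add: U_def V_def sum_product sum.cartesian_product)
      moreover have "?T \<subseteq> {..<n} \<times> {..<n}" by auto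
      ultimately have "U n * V n - W n = (\<Sum>(i,j) \<in> {..<n} \<times> {..<n} - ?T. u i * v j)"
        unfolding W by (simp add: sum_diff)
      also have "nrm \<dots> < e"
      proof (rule nrm_sum_less[OF _ e])
        fix z assume z: "z \<in> {..<n} \<times> {..<n} - ?T"
        obtain i j where ij: "z = (i, j)" by (cases z)
        have "i + j \<ge> 2 * K" using z n by (simp add: ij)
        then show "nrm (case z of (i, j) \<Rightarrow> u i * v j) < e"
          by (simp add: ij small)
      qed
      finally show ?thesis .
    qed
    then show "\<exists>no. \<forall>n\<ge>no. norm (nrm (U n * V n - W n) - 0) < e"
      by (auto simp: nrm_nonneg)
  qed
  have bound: "nrm (W n - a * b) \<le>
      nrm (U n * V n - W n) + (nrm (V n - b) * nrm (U n - a) + (nrm a * nrm (V n - b)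
        + nrm b * nrm (U n - a)))" for n
  proof -
    have eq: "W n - a * b
        = - (U n * V n - W n) + ((V n - b) * (U n - a) + (a * (V n - b) + b * (U n - a)))"
      by (simp add: algebra_simps)
    have "nrm (W n - a * b) \<le> nrm (- (U n * V n - W n))
        + (nrm ((V n - b) * (U n - a)) + (nrm (a * (V n - b)) + nrm (b * (U n - a))))"
      unfolding eq by (rule nrm_triangle4)
    then show ?thesis by (simp only: nrm_minus nrm_mult)
  qed
  have "(\<lambda>n. nrm (U n * V n - W n) + (nrm (V n - b) * nrm (U n - a) + (nrm a * nrm (V n - b)
        + nrm b * nrm (U n - a)))) \<longlonglongrightarrow> 0 + (0 * 0 + (nrm a * 0 + nrm b * 0))"
    by (intro tendsto_add tendsto_mult tendsto_const tail limU limV)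
  then have "(\<lambda>n. nrm (W n - a * b)) \<longlonglongrightarrow> 0"
    by (intro nrm_tendsto_zero_le[OF _ bound]) simp
  then show ?thesis
    by (simp only: fps_sums_def W_def)
qed

text \<open>
  At a point close enough to 0 the lowest nonzero term strictly dominates all later ones, so every
  long partial sum has the norm of that term and cannot tend to 0. The powers of \<open>1/t\<close> supply
  nonzero points arbitrarily close to 0.
\<close>
lemma fps_eq_0_if_sums_0:
  assumes t: "nrm t > 1" and sums: "\<And>x. fps_sums H x 0"
  shows "H = 0"
proof (rule ccontr)
  assume "H \<noteq> 0"
  define m where "m = subdegree H"
  have m: "H $ m \<noteq> 0" and low: "\<And>i. i < m \<Longrightarrow> H $ i = 0"
    using \<open>H \<noteq> 0\<close> by (auto simp: m_def)
  obtain M where "M > 0" and "\<forall>n. nrm (H $ n) \<le> M"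
    using fps_sums_terms_bounded[OF sums[of 1]] by auto
  then have M: "M > 0" "\<And>n. nrm (H $ n) \<le> M"
    by simp_all
  have pos: "nrm (H $ m) > 0"
    using m by (simp add: nrm_pos_iff)
  obtain k where k: "M / nrm (H $ m) < nrm t ^ k"
    using real_arch_pow[OF t] by blast
  define x where "x = inverse t ^ (Suc k)"
  have tx: "nrm x * nrm t ^ Suc k = 1"
  proof -
    have "t \<noteq> 0" using t by auto
    then have "x * t ^ Suc k = 1"
      unfolding x_def by (simp add: power_inverse del: power_Suc)
    then have "nrm (x * t ^ Suc k) = 1" by simp
    then show ?thesis by (simp only: nrm_mult nrm_power)
  qed
  have x0: "nrm x > 0"
    using tx nrm_nonneg[of x] by (cases "nrm x = 0") auto
  have xs: "M * nrm x < nrm (H $ m)"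
  proof -
    have "M < nrm (H $ m) * nrm t ^ Suc k"
    proof -
      have "M < nrm (H $ m) * nrm t ^ k" using k pos by (simp add: field_simps)
      also have "\<dots> \<le> nrm (H $ m) * nrm t ^ Suc k"
        using t by (intro mult_left_mono power_increasing nrm_nonneg) auto
      finally show ?thesis .
    qed
    then have "M * nrm x < nrm (H $ m) * nrm t ^ Suc k * nrm x"
      using x0 by (rule mult_strict_right_mono)
    also have "\<dots> = nrm (H $ m) * (nrm x * nrm t ^ Suc k)"
      by (simp only: mult_ac)
    finally show ?thesis by (simp only: tx mult_1_right)
  qed
  have x1: "nrm x \<le> 1"
  proof (rule ccontr)
    assume "\<not> ?thesis"
    then have "1 * 1 < nrm x * nrm t ^ Suc k"
      using t by (intro mult_strict_mono one_less_power) auto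
    then show False using tx by simp
  qed
  define c where "c = nrm (H $ m * x ^ m)"
  have c0: "c > 0" using pos x0 by (simp add: c_def nrm_mult nrm_power)
  have "nrm (\<Sum>i<n. H $ i * x ^ i) = c" if n: "n > m" for n
  proof -
    have "nrm (H $ i * x ^ i) < c" if "i \<noteq> m" for i
    proof (cases "i < m")
      case True
      then show ?thesis using low c0 by simp
    next
      case False
      then have "Suc m \<le> i" using that by simp
      have "nrm (H $ i * x ^ i) \<le> M * nrm x ^ Suc m"
        unfolding nrm_mult nrm_power
        by (intro mult_mono M power_decreasing \<open>Suc m \<le> i\<close> x1 zero_le_power nrm_nonneg less_imp_le[OF M(1)])
      also have "\<dots> = (M * nrm x) * nrm x ^ m" by simp
      also have "\<dots> < nrm (H $ m) * nrm x ^ m"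
        using xs x0 by (intro mult_strict_right_mono) auto
      finally show ?thesis by (simp add: c_def nrm_mult nrm_power)
    qed
    then have "nrm (\<Sum>i\<in>{..<n} - {m}. H $ i * x ^ i) < c"
      using c0 by (intro nrm_sum_less) auto
    then show ?thesis
      using n by (simp add: sum.remove[of "{..<n}" m] nrm_add_dominant c_def)
  qed
  then have "eventually (\<lambda>n. nrm (\<Sum>i<n. H $ i * x ^ i) = c) sequentially"
    by (intro eventually_sequentiallyI[of "Suc m"]) simp
  then have "(\<lambda>n. nrm (\<Sum>i<n. H $ i * x ^ i)) \<longlonglongrightarrow> c"
    by (rule tendsto_eventually)
  moreover have "(\<lambda>n. nrm (\<Sum>i<n. H $ i * x ^ i)) \<longlonglongrightarrow> 0"
    using sums[of x] by (simp add: fps_sums_def)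
  ultimately show False using LIMSEQ_unique c0 by fastforce
qed

section \<open>The central index\<close>

definition central_index :: "real \<Rightarrow> 'a fps \<Rightarrow> nat \<Rightarrow> bool" where
  "central_index r F k \<longleftrightarrow> F $ k \<noteq> 0 \<and>
     (\<forall>i. nrm (F $ i) * r ^ i \<le> nrm (F $ k) * r ^ k) \<and>
     (\<forall>i>k. nrm (F $ i) * r ^ i < nrm (F $ k) * r ^ k)"

lemma central_index_unique:
  assumes "central_index r F k" and "central_index r F l"
  shows "k = l"
  using assms unfolding central_index_def
  by (metis linorder_neqE_nat not_le)

text \<open>
  Convergence at a point of norm at least \<open>r\<close>, such as a high power of \<open>t\<close>, forces
  \<open>|F\<^sub>i| r\<^sup>i\<close> to tend to 0, so the maximum is attained, and only finitely often.
\<close>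
lemma central_index_exists:
  assumes t: "nrm t > 1" and r: "r > 0" and "F \<noteq> 0"
    and sums: "\<And>x. \<exists>y. fps_sums F x y"
  shows "\<exists>k. central_index r F k"
proof -
  define w where "w i = nrm (F $ i) * r ^ i" for i
  obtain m where m: "F $ m \<noteq> 0"
    using \<open>F \<noteq> 0\<close> by (auto simp: fps_eq_iff)
  then have wm: "w m > 0"
    using r by (simp add: w_def nrm_pos_iff)
  obtain k where k: "r < nrm t ^ k"
    using real_arch_pow[OF t] by blast
  obtain y where "fps_sums F (t ^ k) y"
    using sums by blast
  then have "(\<lambda>n. nrm (F $ n * (t ^ k) ^ n)) \<longlonglongrightarrow> 0"
    by (rule fps_sums_terms_tendsto_zero)
  then have "eventually (\<lambda>n. nrm (F $ n * (t ^ k) ^ n) < w m) sequentially"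
    using wm by (rule order_tendstoD(2))
  then obtain N where "\<forall>n\<ge>N. nrm (F $ n * (t ^ k) ^ n) < w m"
    unfolding eventually_sequentially by (rule exE)
  then have N: "nrm (F $ n * (t ^ k) ^ n) < w m" if "n \<ge> N" for n
    using that by simp
  have wN: "w n < w m" if "n \<ge> N" for n
  proof -
    have "w n \<le> nrm (F $ n * (t ^ k) ^ n)"
      unfolding w_def nrm_mult nrm_power[of "t ^ k"] nrm_power[of t]
      using r k by (intro mult_left_mono power_mono nrm_nonneg) auto
    then show ?thesis using N[OF that] by simp
  qed
  have "m < N" using wN[of m] by force
  define \<mu> where "\<mu> = Max (w ` {..<N})"
  have max: "w i \<le> \<mu>" if "i < N" for i
    using that by (simp add: \<mu>_def)
  have "w m \<le> \<mu>" using max \<open>m < N\<close> .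
  define S where "S = {i. i < N \<and> w i = \<mu>}"
  have "\<mu> \<in> w ` {..<N}"
    unfolding \<mu>_def using \<open>m < N\<close> by (intro Max_in) auto
  then have "S \<noteq> {}" "finite S" by (auto simp: S_def)
  define l where "l = Max S"
  have "l \<in> S" unfolding l_def using \<open>finite S\<close> \<open>S \<noteq> {}\<close> by (rule Max_in)
  then have l: "l < N" "w l = \<mu>" by (auto simp: S_def)
  have all: "w i \<le> w l" for i
    using max[of i] wN[of i] \<open>w m \<le> \<mu>\<close> l by (cases "i < N") auto
  moreover have "w i < w l" if "i > l" for i
  proof (cases "i < N")
    case True
    have "i \<notin> S" using that Max_ge[OF \<open>finite S\<close>, of i] by (auto simp: l_def)
    then show ?thesis using True max[of i] l by (auto simp: S_def)
  next
    case False
    then show ?thesis using wN[of i] \<open>w m \<le> \<mu>\<close> l by simp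
  qed
  moreover have "F $ l \<noteq> 0"
    using all[of m] wm by (auto simp: w_def)
  ultimately show ?thesis
    unfolding central_index_def w_def by blast
qed

text \<open>
  In the coefficient \<open>\<Sum>i\<le>n. F\<^sub>i G\<^sub>n\<^sub>-\<^sub>i\<close> every product of norms is at most the product of the two Gauss
  norms (after scaling by \<open>r\<^sup>n\<close>), with strict inequality as soon as \<open>i > k\<close> or \<open>n - i > l\<close>. For
  \<open>n > k + l\<close> this holds for every \<open>i\<close>; for \<open>n = k + l\<close> it holds for every \<open>i\<close> except \<open>k\<close>, and the
  single dominant term then determines the norm of the coefficient.
\<close>
lemma central_index_mult:
  assumes r: "r > 0" and F: "central_index r F k" and G: "central_index r G l"
  shows "central_index r (F * G) (k + l)"
    and "nrm ((F * G) $ (k + l)) * r ^ (k + l) = (nrm (F $ k) * r ^ k) * (nrm (G $ l) * r ^ l)"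
proof -
  define a b where "a i = nrm (F $ i) * r ^ i" and "b i = nrm (G $ i) * r ^ i" for i
  have nonneg: "a i \<ge> 0" "b i \<ge> 0" for i
    using r by (simp_all add: a_def b_def nrm_nonneg)
  have a: "a i \<le> a k" "i > k \<Longrightarrow> a i < a k" and b: "b i \<le> b l" "i > l \<Longrightarrow> b i < b l" for i
    using F G by (simp_all add: central_index_def a_def b_def)
  have ak: "a k > 0" and bl: "b l > 0"
    using F G r by (simp_all add: central_index_def a_def b_def nrm_pos_iff)
  have term_eq: "nrm (F $ i * G $ (n - i)) = a i * b (n - i) / r ^ n" if "i \<le> n" for i n
  proof -
    have "r ^ n = r ^ i * r ^ (n - i)" using that by (simp flip: power_add)
    then show ?thesis using r by (simp add: a_def b_def nrm_mult)
  qed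
  have le: "a i * b j \<le> a k * b l" for i j
    using a(1) b(1) nonneg by (intro mult_mono) auto
  have less: "a i * b j < a k * b l" if "i > k \<or> j > l" for i j
  proof (cases "i > k")
    case True
    have "a i * b j \<le> a i * b l" using b(1) nonneg by (intro mult_left_mono) auto
    also have "\<dots> < a k * b l" using a(2)[OF True] bl by (rule mult_strict_right_mono)
    finally show ?thesis .
  next
    case False
    then have j: "j > l" using that by simp
    have "a i * b j \<le> a k * b j" using a(1) nonneg by (intro mult_right_mono) auto
    also have "\<dots> < a k * b l" using b(2)[OF j] ak by (rule mult_strict_left_mono)
    finally show ?thesis .
  qed
  have upper: "nrm ((F * G) $ n) * r ^ n \<le> a k * b l" for n
  proof -
    have "nrm ((F * G) $ n) \<le> a k * b l / r ^ n"
      unfolding fps_mult_nth using r ak bl le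
      by (intro nrm_sum_le) (auto simp: term_eq divide_right_mono)
    then show ?thesis using r by (simp add: field_simps)
  qed
  have beyond: "nrm ((F * G) $ n) * r ^ n < a k * b l" if "n > k + l" for n
  proof -
    have "nrm ((F * G) $ n) < a k * b l / r ^ n"
      unfolding fps_mult_nth
    proof (rule nrm_sum_less)
      fix i assume "i \<in> {0..n}"
      then have "i > k \<or> n - i > l" using that by auto
      then show "nrm (F $ i * G $ (n - i)) < a k * b l / r ^ n"
        using less r \<open>i \<in> {0..n}\<close> by (simp add: term_eq divide_strict_right_mono)
    qed (use r ak bl in simp)
    then show ?thesis using r by (simp add: field_simps)
  qed
  have "nrm (\<Sum>i\<in>{0..k + l} - {k}. F $ i * G $ (k + l - i)) < a k * b l / r ^ (k + l)"
  proof (rule nrm_sum_less)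
    fix i assume i: "i \<in> {0..k + l} - {k}"
    then have "i > k \<or> k + l - i > l" by auto
    then show "nrm (F $ i * G $ (k + l - i)) < a k * b l / r ^ (k + l)"
      using less r i by (simp add: term_eq divide_strict_right_mono)
  qed (use r ak bl in simp)
  moreover have "(F * G) $ (k + l)
      = F $ k * G $ l + (\<Sum>i\<in>{0..k + l} - {k}. F $ i * G $ (k + l - i))"
    unfolding fps_mult_nth by (subst sum.remove[of _ k]) auto
  moreover have "nrm (F $ k * G $ l) = a k * b l / r ^ (k + l)"
    using term_eq[of k "k + l"] by simp
  ultimately have "nrm ((F * G) $ (k + l)) = a k * b l / r ^ (k + l)"
    using nrm_add_dominant by simp
  then have eq: "nrm ((F * G) $ (k + l)) * r ^ (k + l) = a k * b l"
    using r by simp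
  then show "nrm ((F * G) $ (k + l)) * r ^ (k + l) = (nrm (F $ k) * r ^ k) * (nrm (G $ l) * r ^ l)"
    by (simp add: a_def b_def)
  have "(F * G) $ (k + l) \<noteq> 0"
  proof
    assume "(F * G) $ (k + l) = 0"
    then have "a k * b l = 0" using eq by simp
    then show False using ak bl by simp
  qed
  then show "central_index r (F * G) (k + l)"
    unfolding central_index_def eq using upper beyond by blast
qed

text \<open>
  The only changed coefficient is the constant one. If \<open>k = 0\<close> it has norm greater than 1 and
  absorbs the summand 1; otherwise its new norm is at most \<open>max 1 |F\<^sub>0|\<close>, which is still bounded by
  the Gauss norm.
\<close>
lemma central_index_one_minus:
  assumes "central_index r F k" and gt: "nrm (F $ k) * r ^ k > 1"
  shows "central_index r (1 - F) k"
proof -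
  have F: "nrm (F $ i) * r ^ i \<le> nrm (F $ k) * r ^ k"
    "i > k \<Longrightarrow> nrm (F $ i) * r ^ i < nrm (F $ k) * r ^ k" for i
    using assms by (auto simp: central_index_def)
  have pos: "nrm ((1 - F) $ i) = nrm (F $ i)" if "i > 0" for i
    using that by (simp add: nrm_minus)
  have zero: "nrm ((1 - F) $ 0) \<le> max 1 (nrm (F $ 0))"
    using nrm_ultra[of 1 "- (F $ 0)"] by (simp add: nrm_minus)
  have k: "nrm ((1 - F) $ k) = nrm (F $ k)"
  proof (cases "k = 0")
    case True
    then show ?thesis
      using gt nrm_add_dominant[of 1 "- (F $ 0)"] by (simp add: nrm_minus)
  next
    case False
    then show ?thesis by (intro pos) simp
  qed
  have "nrm ((1 - F) $ i) * r ^ i \<le> nrm (F $ k) * r ^ k" for i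
    using zero F(1)[of i] gt pos[of i] by (cases "i = 0") auto
  moreover have "nrm ((1 - F) $ i) * r ^ i < nrm (F $ k) * r ^ k" if "i > k" for i
    using F(2)[OF that] that pos[of i] by simp
  moreover have "(1 - F) $ k \<noteq> 0"
    using k gt by (auto simp: nrm_eq_0_iff)
  ultimately show ?thesis
    unfolding central_index_def k by blast
qed

lemma central_index_poly:
  assumes "P \<noteq> 0"
  shows "eventually (\<lambda>r. central_index r (fps_of_poly P) (Polynomial.degree P)) at_top"
proof -
  let ?d = "Polynomial.degree P"
  let ?c = "Polynomial.coeff P"
  have lc: "nrm (?c ?d) > 0"
    using assms by (simp add: nrm_pos_iff)
  have "eventually (\<lambda>r. nrm (?c i) * r ^ i < nrm (?c ?d) * r ^ ?d) at_top" if "i < ?d" for i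
  proof -
    have "eventually (\<lambda>r. r > 1 \<and> r > nrm (?c i) / nrm (?c ?d)) at_top"
      by (intro eventually_conj eventually_gt_at_top)
    then show ?thesis
    proof eventually_elim
      case (elim r)
      have "nrm (?c i) * r ^ i < nrm (?c ?d) * r * r ^ i"
        using elim lc by (intro mult_strict_right_mono) (auto simp: field_simps)
      also have "\<dots> = nrm (?c ?d) * r ^ Suc i" by simp
      also have "\<dots> \<le> nrm (?c ?d) * r ^ ?d"
        using that elim by (intro mult_left_mono power_increasing nrm_nonneg) auto
      finally show ?case .
    qed
  qed
  then have "eventually (\<lambda>r. \<forall>i\<in>{..<?d}. nrm (?c i) * r ^ i < nrm (?c ?d) * r ^ ?d) at_top"
    by (intro eventually_ball_finite) auto
  then show ?thesis
    using eventually_gt_at_top[of 0]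
  proof eventually_elim
    case (elim r)
    have less: "nrm (?c i) * r ^ i < nrm (?c ?d) * r ^ ?d" if "i \<noteq> ?d" for i
      using elim that lc by (cases "i < ?d") (auto simp: Polynomial.coeff_eq_0)
    have "nrm (?c i) * r ^ i \<le> nrm (?c ?d) * r ^ ?d" for i
      using less[of i] by (cases "i = ?d") auto
    with less show ?case
      using assms by (auto simp: central_index_def)
  qed
qed

section \<open>The parity argument\<close>

text \<open>
  Both series occur symmetrically in the equation, so it suffices to treat the first one; the second
  follows by exchanging the roles of \<open>A, F\<close> and \<open>B, G\<close>.
\<close>
lemma no_nonconstant_fps_solution:
  assumes t: "nrm t > 1" and AB: "A \<noteq> 0" "B \<noteq> 0"
    and parity: "\<not> [Polynomial.degree A = Polynomial.degree B] (mod 2)"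
    and F: "\<And>x. \<exists>y. fps_sums F x y" and G: "\<And>x. \<exists>y. fps_sums G x y"
    and eq: "fps_of_poly A * F\<^sup>2 + fps_of_poly B * G\<^sup>2 = 1"
    and "i > 0"
  shows "F $ i = 0"
proof (rule ccontr)
  assume i: "F $ i \<noteq> 0"
  let ?dA = "Polynomial.degree A" and ?dB = "Polynomial.degree B"
  \<comment> \<open>The Gauss norm of \<open>F\<close> is at least \<open>b * r\<close> and that of \<open>A\<close> at least \<open>c\<close>. The radius is taken
    so large that \<open>b * r\<close> and \<open>b * c * r\<close> exceed 1, which makes that of \<open>A F\<^sup>2\<close> exceed 1.\<close>
  define c where "c = nrm (Polynomial.coeff A ?dA)"
  define b where "b = nrm (F $ i)"
  have c: "c > 0" and b: "b > 0"
    using AB(1) i by (simp_all add: c_def b_def nrm_pos_iff)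
  have "eventually (\<lambda>r. central_index r (fps_of_poly A) ?dA
      \<and> central_index r (fps_of_poly B) ?dB \<and> r > 1 \<and> r > 1 / b \<and> r > 1 / (b * c)) at_top"
    by (intro eventually_conj central_index_poly AB eventually_gt_at_top)
  then obtain r where A: "central_index r (fps_of_poly A) ?dA"
    and B: "central_index r (fps_of_poly B) ?dB"
    and r: "r > 1" "r > 1 / b" "r > 1 / (b * c)"
    using eventually_happens by fastforce
  have r0: "r > 0" using r by simp
  have "F \<noteq> 0" using i by auto
  then obtain k where k: "central_index r F k"
    using central_index_exists[OF t r0 _ F] by blast
  define \<mu> where "\<mu> = nrm (F $ k) * r ^ k"
  have "b * r \<le> b * r ^ i"
    using r b power_increasing[of 1 i r] \<open>i > 0\<close> by simp
  also have "\<dots> \<le> \<mu>"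
    using k by (simp add: central_index_def b_def \<mu>_def)
  finally have br: "b * r \<le> \<mu>" .
  have "1 < b * r" "1 < c * (b * r)"
    using r b c by (simp_all add: field_simps)
  with br c have \<mu>: "1 < \<mu>" "1 < c * \<mu>"
    by (auto intro: less_le_trans[OF _ mult_left_mono])
  have FF: "central_index r (F\<^sup>2) (k + k)"
    and FFn: "nrm (F\<^sup>2 $ (k + k)) * r ^ (k + k) = \<mu> * \<mu>"
    using central_index_mult[OF r0 k k] by (simp_all add: power2_eq_square \<mu>_def)
  have AF: "central_index r (fps_of_poly A * F\<^sup>2) (?dA + (k + k))"
    and AFn: "nrm ((fps_of_poly A * F\<^sup>2) $ (?dA + (k + k))) * r ^ (?dA + (k + k))
      = (c * r ^ ?dA) * (\<mu> * \<mu>)"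
    using central_index_mult[OF r0 A FF] FFn by (simp_all add: c_def)
  have "1 < (c * \<mu>) * \<mu>"
    using \<mu> by (rule less_1_mult[rotated])
  also have "\<dots> \<le> (c * \<mu>) * \<mu> * r ^ ?dA"
    using r \<mu> c by (simp add: one_le_power)
  finally have "1 < (c * r ^ ?dA) * (\<mu> * \<mu>)"
    by (simp add: mult_ac)
  then have "central_index r (1 - fps_of_poly A * F\<^sup>2) (?dA + (k + k))"
    using AF AFn by (intro central_index_one_minus) auto
  moreover have "1 - fps_of_poly A * F\<^sup>2 = fps_of_poly B * G\<^sup>2"
    using eq by (simp add: algebra_simps)
  ultimately have BG: "central_index r (fps_of_poly B * G\<^sup>2) (?dA + (k + k))"
    by simp
  then have "G \<noteq> 0" by (auto simp: central_index_def)
  then obtain l where l: "central_index r G l"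
    using central_index_exists[OF t r0 _ G] by blast
  have "central_index r (fps_of_poly B * G\<^sup>2) (?dB + (l + l))"
    using central_index_mult(1)[OF r0 B central_index_mult(1)[OF r0 l l]]
    by (simp add: power2_eq_square)
  with BG have "?dA + (k + k) = ?dB + (l + l)"
    by (rule central_index_unique)
  then show False
    using parity unfolding Cong.cong_def by presburger
qed

lemma fps_sums_const:
  assumes "fps_sums F x a" and "\<And>i. i > 0 \<Longrightarrow> F $ i = 0"
  shows "a = F $ 0"
proof -
  have "(\<Sum>i<n. F $ i * x ^ i) = F $ 0" if "n > 0" for n
    using that assms(2) by (subst sum.remove[of _ 0]) (auto intro!: sum.neutral)
  then have "eventually (\<lambda>n. nrm ((\<Sum>i<n. F $ i * x ^ i) - a) = nrm (F $ 0 - a)) sequentially"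
    by (intro eventually_sequentiallyI[of 1]) simp
  then have "(\<lambda>n. nrm ((\<Sum>i<n. F $ i * x ^ i) - a)) \<longlonglongrightarrow> nrm (F $ 0 - a)"
    by (rule tendsto_eventually)
  then have "nrm (F $ 0 - a) = 0"
    using assms(1) LIMSEQ_unique unfolding fps_sums_def by blast
  then show ?thesis by (simp add: nrm_eq_0_iff)
qed

theorem entire_solutions_constant:
  assumes t: "nrm t > 1" and AB: "A \<noteq> 0" "B \<noteq> 0"
    and parity: "\<not> [Polynomial.degree A = Polynomial.degree B] (mod 2)"
    and fg: "f \<in> entire_functions" "g \<in> entire_functions"
    and eq: "\<And>x. poly A x * (f x)\<^sup>2 + poly B x * (g x)\<^sup>2 = 1"
  shows "f \<in> constant_functions" and "g \<in> constant_functions"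
proof -
  obtain F where "\<forall>x. fps_sums F x (f x)"
    using entire_function_fps[OF fg(1)] by blast
  then have F: "fps_sums F x (f x)" for x by simp
  obtain G where "\<forall>x. fps_sums G x (g x)"
    using entire_function_fps[OF fg(2)] by blast
  then have G: "fps_sums G x (g x)" for x by simp
  define H where "H = 1 - fps_of_poly A * F\<^sup>2 - fps_of_poly B * G\<^sup>2"
  have "fps_sums H x 0" for x
  proof -
    have "fps_sums H x (1 - poly A x * (f x)\<^sup>2 - poly B x * (g x)\<^sup>2)"
      unfolding H_def power2_eq_square using fps_sums_poly[of 1 x]
      by (intro fps_sums_diff fps_sums_mult fps_sums_poly F G) simp
    also have "1 - poly A x * (f x)\<^sup>2 - poly B x * (g x)\<^sup>2 = 0"
      using eq[of x] by (simp add: algebra_simps)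
    finally show ?thesis .
  qed
  then have "H = 0" by (rule fps_eq_0_if_sums_0[OF t])
  then have FG: "fps_of_poly A * F\<^sup>2 + fps_of_poly B * G\<^sup>2 = 1"
    by (simp add: H_def algebra_simps)
  then have GF: "fps_of_poly B * G\<^sup>2 + fps_of_poly A * F\<^sup>2 = 1"
    by (simp add: add.commute)
  have parity': "\<not> [Polynomial.degree B = Polynomial.degree A] (mod 2)"
    using parity by (simp add: Cong.cong_sym_eq)
  have "F $ i = 0" if "i > 0" for i
    using no_nonconstant_fps_solution[OF t AB parity _ _ FG that] F G by blast
  then have "f = (\<lambda>x. F $ 0)"
    using fps_sums_const[OF F] by blast
  then show "f \<in> constant_functions"
    by (auto simp: constant_functions_def)
  have "G $ i = 0" if "i > 0" for i
    using no_nonconstant_fps_solution[OF t AB(2,1) parity' _ _ GF that] F G by blast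
  then have "g = (\<lambda>x. G $ 0)"
    using fps_sums_const[OF G] by blast
  then show "g \<in> constant_functions"
    by (auto simp: constant_functions_def)
qed

end

lemma (in complex_padic_field) nrm_inverse_prime:
  assumes "Factorial_Ring.prime p"
  shows "nrm (inverse (of_nat p)) > 1"
proof -
  have p: "p > 1" using assms by (rule prime_gt_1_nat)
  have "quotient_of (of_nat p) = (int p, 1)"
    using quotient_of_int[of "int p"] by (simp add: Rat.of_int_def)
  then have "nrm (of_nat p) = inverse (real p)"
    using nrm_of_rat[of "of_nat p"] p multiplicity_self[of "int p"]
    by (simp add: padic_abs_def power_int_minus)
  moreover have "nrm (of_nat p) * nrm (inverse (of_nat p)) = 1"
    using p by (simp flip: nrm_mult)
  ultimately have "inverse (inverse (real p)) = nrm (inverse (of_nat p))"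
    by (intro inverse_unique) simp
  then show ?thesis using p by simp
qed

theorem mainTheorem2:
  fixes p :: nat
    and nrm :: "'a :: field_char_0 \<Rightarrow> real"
    and A B :: "'a poly"
  assumes "Factorial_Ring.prime p"
    and "complex_padic_field p nrm"
    and "A \<noteq> 0" and "B \<noteq> 0"
    and "\<not> [Polynomial.degree A = Polynomial.degree B] (mod 2)"
  shows "\<not> (\<exists>f g.
           (f, g) \<in> (nonarch_valued_field.entire_functions nrm
                      \<times> nonarch_valued_field.entire_functions nrm)
                    - (constant_functions \<times> constant_functions) \<and>
           (\<forall>x. poly A x * (f x)\<^sup>2 + poly B x * (g x)\<^sup>2 = 1))"
proof -
  interpret complex_padic_field p nrm by fact
  show ?thesis
    using entire_solutions_constant[OF nrm_inverse_prime[OF assms(1)] assms(3-5)] by blast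
qed

end
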